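(* Let $m$ and $n$ be two distinct square-free positive integers with $m\equiv 3 \pmod 4$ and $n\equiv 1 \pmod 4$, and let $K=\mathbb{Q}(\sqrt{-m},\sqrt{n})$ with ring of integers $\mathcal{O}_K$. Then $\mathcal{R}_K=\mathcal{O}_K$, i.e. every element of $\mathcal{O}_K$ is a sum of squares of elements of $\mathcal{O}_K$.
   Context: $\mathcal{R}_K$ denotes the set of elements of $\mathcal{O}_K$ that are sums of (finitely many) squares of elements of $\mathcal{O}_K$. *)

theory Defs
  imports Complex_Main "HOL-Algebra.Generated_Fields" "HOL-Algebra.Algebraic_Closure_Type"
    "HOL-Computational_Algebra.Squarefree"
begin

text \<open>
  Number fields are realised as subfields of the complex numbers. A subfield contains 1 and hence
  all rationals, so adjoining \<open>S\<close> to the rationals is the same as generating a field by \<open>S\<close>.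
\<close>

definition rat_adjoin :: "complex set \<Rightarrow> complex set" where
  "rat_adjoin S = generate_field ring_of_type_algebra S"

definition ring_of_integers :: "complex set \<Rightarrow> complex set" where
  "ring_of_integers K = {x \<in> K. algebraic_int x}"

definition sums_of_squares :: "complex set \<Rightarrow> complex set" where
  "sums_of_squares R = {x \<in> R. \<exists>ys. set ys \<subseteq> R \<and> x = (\<Sum>y\<leftarrow>ys. y ^ 2)}"

end

theory Submission
  imports Defs "Jordan_Normal_Form.Char_Poly"
begin

text \<open>
  The sums of squares of \<open>\<O>\<^sub>K\<close> are closed under addition and multiplication, and contain \<open>-1\<close> because
  \<open>-1 = \<alpha>\<^sup>2 + (m - 1)\<close> for \<open>\<alpha> = \<surd>(-m)\<close>. So they form a ring, which contains every
  \<open>2z = (z + 1)\<^sup>2 - z\<^sup>2 - 1\<close> and hence every \<open>x\<close> with an odd multiple \<open>k x\<close> in it. It also contains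
  \<open>(1 + \<gamma>)/2\<close> for \<open>\<gamma> = \<alpha>\<close> and \<open>\<gamma> = \<surd>n\<close>, as this element differs from its square by an integer.
  If \<open>\<gamma>\<^sup>2 = d \<equiv> 1\<close> modulo 4, then an integer \<open>x\<close> of \<open>F(\<gamma>)\<close> has \<open>d x\<close> in the span of \<open>1\<close> and
  \<open>(1 + \<gamma>)/2\<close> over the integers of the subfield \<open>F\<close>, with coefficients given by traces. Two such
  steps lead from the rationals through \<open>\<rat>(\<surd>n)\<close> to \<open>K\<close>.
\<close>

unbundle no fps_syntax

section \<open>Closure of the algebraic integers under addition and multiplication\<close>

text \<open>Meant for finite \<open>B\<close>: over an infinite \<open>B\<close> the sum defaults to
  0.\<close>

definition int_span :: "'a::comm_ring_1 set \<Rightarrow> 'a set" where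
  "int_span B = {\<Sum>b\<in>B. of_int (c b) * b |c. True}"

lemma int_spanI: "x = (\<Sum>b\<in>B. of_int (c b) * b) \<Longrightarrow> x \<in> int_span B"
  unfolding int_span_def by blast

lemma int_spanE:
  assumes "x \<in> int_span B"
  obtains c where "x = (\<Sum>b\<in>B. of_int (c b) * b)"
  using assms unfolding int_span_def by blast

lemma int_span_base:
  assumes "finite B" and "b \<in> B"
  shows "b \<in> int_span B"
proof (rule int_spanI[where c = "\<lambda>x. if x = b then 1 else 0"])
  have "(\<Sum>x\<in>B. of_int (if x = b then 1 else 0) * x) = (\<Sum>x\<in>B. if x = b then x else 0)"
    by (rule sum.cong) auto
  then show "b = (\<Sum>x\<in>B. of_int (if x = b then 1 else 0) * x)"
    using assms by simp
qed

lemma int_span_0: "0 \<in> int_span B"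
  by (rule int_spanI[where c = "\<lambda>_. 0"]) simp

lemma int_span_add:
  assumes "x \<in> int_span B" and "y \<in> int_span B"
  shows "x + y \<in> int_span B"
proof -
  obtain c c' where "x = (\<Sum>b\<in>B. of_int (c b) * b)" "y = (\<Sum>b\<in>B. of_int (c' b) * b)"
    using assms by (elim int_spanE)
  then show ?thesis
    by (intro int_spanI[where c = "\<lambda>b. c b + c' b"]) (simp add: distrib_right sum.distrib)
qed

lemma int_span_of_int_mult:
  assumes "x \<in> int_span B"
  shows "of_int k * x \<in> int_span B"
proof -
  obtain c where "x = (\<Sum>b\<in>B. of_int (c b) * b)"
    using assms by (elim int_spanE)
  then show ?thesis
    by (intro int_spanI[where c = "\<lambda>b. k * c b"]) (simp add: sum_distrib_left mult.assoc)
qed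

lemma int_span_sum: "(\<And>i. i \<in> I \<Longrightarrow> f i \<in> int_span B) \<Longrightarrow> sum f I \<in> int_span B"
  by (induction I rule: infinite_finite_induct) (auto intro: int_span_0 int_span_add)

text \<open>Multiplication by \<open>z\<close> is additive, so generators suffice. This allows two
  stabilising multiplications to be composed, as products \<open>x * y\<close> require.\<close>

lemma int_span_mult_closed:
  assumes "\<And>b. b \<in> B \<Longrightarrow> z * b \<in> int_span B" and "x \<in> int_span B"
  shows "z * x \<in> int_span B"
proof -
  obtain c where x: "x = (\<Sum>b\<in>B. of_int (c b) * b)"
    using assms(2) by (rule int_spanE)
  have "z * x = (\<Sum>b\<in>B. of_int (c b) * (z * b))"
    unfolding x by (simp add: sum_distrib_left mult_ac)
  also have "\<dots> \<in> int_span B"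
    by (intro int_span_sum int_span_of_int_mult assms(1))
  finally show ?thesis .
qed

text \<open>\<open>z\<close> is an eigenvalue of an integer matrix, hence a root of its characteristic polynomial.\<close>

lemma algebraic_int_if_stable_span:
  fixes z :: "'a::field_char_0"
  assumes "finite B" and "b0 \<in> B" and "b0 \<noteq> 0"
    and stable: "\<And>b. b \<in> B \<Longrightarrow> z * b \<in> int_span B"
  shows "algebraic_int z"
proof -
  obtain bs where bs: "set bs = B" "distinct bs"
    using finite_distinct_list[OF \<open>finite B\<close>] by blast
  define n where "n = length bs"
  have "\<forall>b\<in>B. \<exists>c. z * b = (\<Sum>b'\<in>B. of_int (c b') * b')"
    using stable unfolding int_span_def by blast
  then obtain c where c: "\<And>b. b \<in> B \<Longrightarrow> z * b = (\<Sum>b'\<in>B. of_int (c b b') * b')"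
    by metis
  define A :: "int mat" where "A = mat n n (\<lambda>(i, j). c (bs ! i) (bs ! j))"
  define v where "v = vec n ((!) bs)"
  have A: "A \<in> carrier_mat n n" by (simp add: A_def)
  have "map_mat of_int A *\<^sub>v v = z \<cdot>\<^sub>v v"
  proof (rule eq_vecI)
    fix i assume "i < dim_vec (z \<cdot>\<^sub>v v)"
    then have i: "i < n" by (simp add: v_def)
    have "(\<Sum>j<n. of_int (c (bs ! i) (bs ! j)) * bs ! j) = z * bs ! i"
      using c[of "bs ! i"] i bs
        sum.reindex_bij_betw[OF bij_betw_nth[OF bs(2) refl bs(1)[symmetric]],
          of "\<lambda>b'. of_int (c (bs ! i) b') * b'"]
      by (auto simp: n_def)
    then show "(map_mat of_int A *\<^sub>v v) $ i = (z \<cdot>\<^sub>v v) $ i"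
      using i by (simp add: A_def v_def scalar_prod_def atLeast0LessThan)
  qed (simp add: A_def v_def)
  \<comment> \<open>The nonzero generator \<open>b0\<close> is an entry of \<open>v\<close>, so
    \<open>v\<close> is a genuine eigenvector.\<close>
  moreover obtain k where k: "k < n" "bs ! k = b0"
    using \<open>b0 \<in> B\<close> bs(1) by (metis in_set_conv_nth n_def)
  then have "v \<noteq> 0\<^sub>v n"
    using \<open>b0 \<noteq> 0\<close> unfolding v_def by (metis index_vec index_zero_vec(1))
  ultimately have "eigenvalue (map_mat of_int A) z"
    unfolding eigenvalue_def eigenvector_def using A by (intro exI[of _ v]) (simp add: v_def)
  then have "poly (char_poly (map_mat of_int A)) z = 0"
    using eigenvalue_root_char_poly[of "map_mat of_int A" n z] A by simp
  then have "poly (map_poly of_int (char_poly A)) z = 0"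
    by (simp add: of_int_hom.char_poly_hom[OF A])
  moreover have "lead_coeff (char_poly A) = 1"
    using degree_monic_char_poly[OF A] by simp
  ultimately show ?thesis
    unfolding algebraic_int_altdef_ipoly by blast
qed

text \<open>A monic relation in the form of a rewrite rule for the top power. Positivity of
  \<open>d\<close> puts \<open>x ^ 0 = 1\<close> among the remaining powers.\<close>

lemma algebraic_int_power_degree:
  fixes x :: "'a::field_char_0"
  assumes "algebraic_int x"
  obtains d :: nat and c :: "nat \<Rightarrow> int" where "d > 0" "x ^ d = (\<Sum>i<d. of_int (c i) * x ^ i)"
proof -
  obtain p :: "int poly" where p: "poly (map_poly of_int p) x = 0" "lead_coeff p = 1"
    using assms unfolding algebraic_int_altdef_ipoly by blast
  have "degree p > 0"
  proof (rule ccontr)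
    assume "\<not> degree p > 0"
    then obtain a where "p = [:a:]" by (auto elim: degree_eq_zeroE)
    with p show False by simp
  qed
  have "(\<Sum>i<degree p. of_int (coeff p i) * x ^ i) + x ^ degree p = 0"
    using p by (simp add: poly_altdef flip: lessThan_Suc_atMost)
  from minus_unique[OF this] have "x ^ degree p = (\<Sum>i<degree p. of_int (- coeff p i) * x ^ i)"
    by (simp only: of_int_minus mult_minus_left sum_negf)
  with \<open>degree p > 0\<close> show ?thesis by (rule that)
qed

text \<open>Multiplication by \<open>x\<close> shifts the exponent \<open>i\<close>; only
  \<open>i = d - 1\<close> leaves the range, and there the relation for \<open>x ^ d\<close> brings
  it back. Nothing is assumed about \<open>y\<close>, so the roles can be swapped.\<close>

lemma stable_span_powers:
  fixes x y :: "'a::field_char_0"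
  assumes "x ^ d = (\<Sum>i<d. of_int (c i) * x ^ i)"
    and "b \<in> (\<lambda>(i, j). x ^ i * y ^ j) ` ({..<d} \<times> {..<e})"
  shows "x * b \<in> int_span ((\<lambda>(i, j). x ^ i * y ^ j) ` ({..<d} \<times> {..<e}))"
    (is "_ \<in> int_span ?B")
proof -
  obtain i j where ij: "i < d" "j < e" "b = x ^ i * y ^ j" using assms(2) by auto
  have base: "x ^ k * y ^ j \<in> int_span ?B" if "k < d" for k
    using that ij(2) by (intro int_span_base) auto
  show ?thesis
  proof (cases "Suc i = d")
    case True
    have "x * b = x ^ d * y ^ j" using True ij(3) by auto
    also have "\<dots> = (\<Sum>k<d. of_int (c k) * (x ^ k * y ^ j))"
      by (simp add: assms(1) sum_distrib_right mult.assoc)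
    also have "\<dots> \<in> int_span ?B"
      by (intro int_span_sum int_span_of_int_mult base) auto
    finally show ?thesis .
  next
    case False
    then show ?thesis using base[of "Suc i"] ij by (simp add: mult.assoc)
  qed
qed

text \<open>The monomials \<open>x ^ i * y ^ j\<close> below both degrees span a group stable under
  \<open>x\<close> and \<open>y\<close>, hence under their sum and product; 1 is the required
  nonzero generator.\<close>

lemma
  fixes x y :: "'a::field_char_0"
  assumes "algebraic_int x" and "algebraic_int y"
  shows algebraic_int_add: "algebraic_int (x + y)"
    and algebraic_int_mult: "algebraic_int (x * y)"
proof -
  obtain d c where d: "d > 0" "x ^ d = (\<Sum>i<d. of_int (c i) * x ^ i)"
    using algebraic_int_power_degree[OF assms(1)] by blast
  obtain e c' where e: "e > 0" "y ^ e = (\<Sum>i<e. of_int (c' i) * y ^ i)"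
    using algebraic_int_power_degree[OF assms(2)] by blast
  define B where "B = (\<lambda>(i, j). x ^ i * y ^ j) ` ({..<d} \<times> {..<e})"
  have B': "B = (\<lambda>(i, j). y ^ i * x ^ j) ` ({..<e} \<times> {..<d})"
    unfolding B_def by (force simp: mult.commute)
  have B: "finite B" "1 \<in> B" using d(1) e(1) by (force simp: B_def)+
  have x: "x * b \<in> int_span B" if "b \<in> B" for b
    using stable_span_powers[OF d(2)] that unfolding B_def by blast
  have y: "y * b \<in> int_span B" if "b \<in> B" for b
    using stable_span_powers[OF e(2)] that unfolding B' by blast
  show "algebraic_int (x + y)"
    using B x y by (intro algebraic_int_if_stable_span[of B 1])
      (auto simp: distrib_right intro: int_span_add)
  show "algebraic_int (x * y)"
    using B x y by (intro algebraic_int_if_stable_span[of B 1])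
      (auto simp: mult.assoc intro: int_span_mult_closed)
qed

section \<open>Integrality of quadratic elements and their conjugates\<close>

lemma algebraic_int_quadratic:
  fixes x :: "'a::field_char_0"
  assumes "x\<^sup>2 = x + of_int k"
  shows "algebraic_int x"
proof (rule algebraic_int.intros[of "[:- of_int k, -1, 1:]"])
  show "\<forall>i. coeff [:- of_int k, -1, 1:] i \<in> (\<int> :: 'a set)"
    by (auto simp: coeff_pCons split: nat.splits)
  show "poly [:- of_int k, -1, 1:] x = 0"
    using assms by (simp add: power2_eq_square algebra_simps)
qed simp

text \<open>An evaluation at \<open>P - Q\<gamma>\<close> is the formal conjugate of the evaluation at \<open>P + Q\<gamma>\<close>.\<close>

lemma algebraic_int_quadratic_conjugate:
  fixes \<gamma> P Q :: "'a::field_char_0"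
  assumes "\<gamma> \<notin> \<rat>" and "\<gamma>\<^sup>2 \<in> \<rat>" and "P \<in> \<rat>" and "Q \<in> \<rat>"
    and "algebraic_int (P + Q * \<gamma>)"
  shows "algebraic_int (P - Q * \<gamma>)"
proof -
  \<comment> \<open>Horner's scheme: each step multiplies by P \<plusminus> Q\<gamma> and adds an
    integer. Since \<gamma> squared is rational, both parts stay rational and the two values keep
    opposite signs at \<gamma>.\<close>
  have rational_parts: "\<exists>A\<in>\<rat>. \<exists>B\<in>\<rat>. poly (map_poly of_int p) (P + Q * \<gamma>) = A + B * \<gamma> \<and>
      poly (map_poly of_int p) (P - Q * \<gamma>) = A - B * \<gamma>" for p :: "int poly"
  proof (induction p)
    case 0
    show ?case by (intro bexI[of _ 0]) auto
  next
    case (pCons c p)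
    then obtain A B where AB: "A \<in> \<rat>" "B \<in> \<rat>"
      "poly (map_poly of_int p) (P + Q * \<gamma>) = A + B * \<gamma>"
      "poly (map_poly of_int p) (P - Q * \<gamma>) = A - B * \<gamma>" by blast
    show ?case
    proof (intro bexI conjI)
      show "poly (map_poly of_int (pCons c p)) (P + Q * \<gamma>)
          = (of_int c + P * A + Q * B * \<gamma>\<^sup>2) + (P * B + Q * A) * \<gamma>"
        unfolding of_int_hom.map_poly_pCons_hom poly_pCons AB(3)
        by (simp add: power2_eq_square algebra_simps)
      show "poly (map_poly of_int (pCons c p)) (P - Q * \<gamma>)
          = (of_int c + P * A + Q * B * \<gamma>\<^sup>2) - (P * B + Q * A) * \<gamma>"
        unfolding of_int_hom.map_poly_pCons_hom poly_pCons AB(4)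
        by (simp add: power2_eq_square algebra_simps)
    qed (use assms AB in \<open>auto intro!: Rats_add Rats_mult\<close>)
  qed
  obtain p :: "int poly" where p: "poly (map_poly of_int p) (P + Q * \<gamma>) = 0" "lead_coeff p = 1"
    using assms(5) unfolding algebraic_int_altdef_ipoly by blast
  obtain A B where AB: "A \<in> \<rat>" "B \<in> \<rat>"
    "poly (map_poly of_int p) (P + Q * \<gamma>) = A + B * \<gamma>"
    "poly (map_poly of_int p) (P - Q * \<gamma>) = A - B * \<gamma>" using rational_parts by blast
  \<comment> \<open>Irrationality of \<gamma> forces both parts to vanish, so the conjugate is a
    root of the same monic polynomial.\<close>
  have "B = 0"
  proof (rule ccontr)
    assume "B \<noteq> 0"
    then have "\<gamma> = - A / B" using AB(3) p(1) by (simp add: field_simps add_eq_0_iff)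
    with AB(1,2) assms(1) show False by simp
  qed
  with AB(3,4) p show ?thesis
    unfolding algebraic_int_altdef_ipoly by (metis diff_zero add_0_right mult_zero_left)
qed

section \<open>Subrings of the complex numbers and their sums of squares\<close>

text \<open>One notion on plain sets, interpreted for the fields, for the ring of integers and for
  its set of sums of squares.\<close>

locale complex_subring =
  fixes R :: "complex set"
  assumes one: "1 \<in> R"
    and uminus: "x \<in> R \<Longrightarrow> - x \<in> R"
    and add: "x \<in> R \<Longrightarrow> y \<in> R \<Longrightarrow> x + y \<in> R"
    and mult: "x \<in> R \<Longrightarrow> y \<in> R \<Longrightarrow> x * y \<in> R"
begin

lemma zero: "0 \<in> R"
  using add[OF one uminus[OF one]] by simp

lemma diff: "x \<in> R \<Longrightarrow> y \<in> R \<Longrightarrow> x - y \<in> R"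
  using add[OF _ uminus, of x y] by simp

lemma of_nat: "of_nat k \<in> R"
  by (induction k) (auto intro: zero one add)

lemma of_int: "of_int k \<in> R"
  by (cases k) (use of_nat uminus in \<open>auto simp flip: of_nat_Suc simp del: of_nat_Suc\<close>)

lemma numeral: "numeral k \<in> R"
  using of_nat[of "numeral k"] by simp

lemma power2: "x \<in> R \<Longrightarrow> x\<^sup>2 \<in> R"
  by (simp add: power2_eq_square mult)

lemma sum_list_squares: "set ys \<subseteq> R \<Longrightarrow> (\<Sum>y\<leftarrow>ys. y\<^sup>2) \<in> R"
  by (induction ys) (auto intro: zero add power2)

lemma sums_of_squaresI: "set ys \<subseteq> R \<Longrightarrow> x = (\<Sum>y\<leftarrow>ys. y\<^sup>2) \<Longrightarrow> x \<in> sums_of_squares R"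
  unfolding sums_of_squares_def using sum_list_squares by blast

lemma sums_of_squaresE:
  assumes "x \<in> sums_of_squares R"
  obtains ys where "set ys \<subseteq> R" "x = (\<Sum>y\<leftarrow>ys. y\<^sup>2)"
  using assms unfolding sums_of_squares_def by blast

lemma sos_square: "y \<in> R \<Longrightarrow> y\<^sup>2 \<in> sums_of_squares R"
  by (rule sums_of_squaresI[of "[y]"]) auto

lemma sos_add:
  assumes "x \<in> sums_of_squares R" and "y \<in> sums_of_squares R"
  shows "x + y \<in> sums_of_squares R"
proof -
  obtain xs ys where "set xs \<subseteq> R" "x = (\<Sum>y\<leftarrow>xs. y\<^sup>2)" "set ys \<subseteq> R" "y = (\<Sum>y\<leftarrow>ys. y\<^sup>2)"
    using assms by (elim sums_of_squaresE)
  then show ?thesis by (intro sums_of_squaresI[of "xs @ ys"]) auto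
qed

lemma sos_mult_square:
  assumes "x \<in> sums_of_squares R" and "y \<in> R"
  shows "x * y\<^sup>2 \<in> sums_of_squares R"
proof -
  obtain xs where "set xs \<subseteq> R" "x = (\<Sum>y\<leftarrow>xs. y\<^sup>2)"
    using assms(1) by (rule sums_of_squaresE)
  then show ?thesis using assms(2)
    by (intro sums_of_squaresI[of "map (\<lambda>z. z * y) xs"])
      (auto simp: o_def power_mult_distrib sum_list_mult_const intro: mult)
qed

lemma sos_0: "0 \<in> sums_of_squares R"
  by (rule sums_of_squaresI[of "[]"]) auto

text \<open>Distribute over the squares making up \<open>y\<close>; each such factor is absorbed
  into the squares of \<open>x\<close>.\<close>

lemma sos_mult:
  assumes "x \<in> sums_of_squares R" and "y \<in> sums_of_squares R"
  shows "x * y \<in> sums_of_squares R"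
proof -
  obtain ys where ys: "set ys \<subseteq> R" "y = (\<Sum>y\<leftarrow>ys. y\<^sup>2)"
    using assms(2) by (rule sums_of_squaresE)
  have "x * (\<Sum>y\<leftarrow>ys. y\<^sup>2) \<in> sums_of_squares R"
    using ys(1) by (induction ys) (auto simp: distrib_left intro: sos_0 sos_add sos_mult_square assms(1))
  with ys(2) show ?thesis by simp
qed

lemma sos_of_nat: "of_nat k \<in> sums_of_squares R"
  using sos_square[OF one] by (induction k) (auto intro: sos_0 sos_add)

lemma sos_subring:
  assumes "- 1 \<in> sums_of_squares R"
  shows "complex_subring (sums_of_squares R)"
proof
  show "1 \<in> sums_of_squares R" using sos_square[OF one] by simp
  show "- x \<in> sums_of_squares R" if "x \<in> sums_of_squares R" for x
    using sos_mult[OF assms that] by simp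
qed (fact sos_add sos_mult)+

lemma sos_double:
  assumes "- 1 \<in> sums_of_squares R" and "z \<in> R"
  shows "2 * z \<in> sums_of_squares R"
proof -
  interpret S: complex_subring "sums_of_squares R" by (rule sos_subring[OF assms(1)])
  have "(z + 1)\<^sup>2 - z\<^sup>2 - 1 \<in> sums_of_squares R"
    by (intro S.diff S.one sos_square add one assms(2))
  then show ?thesis by (simp add: power2_eq_square algebra_simps)
qed

text \<open>For \<open>k = 2 * l + 1\<close> the elements \<open>x\<close> and \<open>k x\<close>
  differ by a double, which \<open>sos_double\<close> covers.\<close>

lemma sos_cancel_odd:
  assumes "- 1 \<in> sums_of_squares R" and "odd k" and "x \<in> R"
    and "of_int k * x \<in> sums_of_squares R"
  shows "x \<in> sums_of_squares R"
proof -
  interpret S: complex_subring "sums_of_squares R" by (rule sos_subring[OF assms(1)])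
  obtain l where "k = 2 * l + 1" using \<open>odd k\<close> by (rule oddE)
  then have "x = of_int k * x - 2 * (of_int l * x)" by (simp add: algebra_simps)
  also have "\<dots> \<in> sums_of_squares R"
    by (intro S.diff sos_double mult of_int assms)
  finally show ?thesis .
qed

lemma sos_quadratic:
  assumes "- 1 \<in> sums_of_squares R" and "c \<in> R" and "c\<^sup>2 = c + of_int k"
  shows "c \<in> sums_of_squares R"
proof -
  interpret S: complex_subring "sums_of_squares R" by (rule sos_subring[OF assms(1)])
  have "c\<^sup>2 - of_int k \<in> sums_of_squares R"
    by (intro S.diff sos_square S.of_int assms(2))
  with assms(3) show ?thesis by simp
qed

end

section \<open>Subfields and quadratic extensions\<close>

locale complex_subfield = complex_subring F for F +
  assumes inverse: "x \<in> F \<Longrightarrow> inverse x \<in> F"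
begin

lemma divide: "x \<in> F \<Longrightarrow> y \<in> F \<Longrightarrow> x / y \<in> F"
  by (simp add: divide_inverse mult inverse)

lemma Rats_subset: "\<rat> \<subseteq> F"
  by (auto elim!: Rats_cases' intro!: divide of_int)

lemma ring_of_integers_subring: "complex_subring (ring_of_integers F)"
  unfolding ring_of_integers_def
  by unfold_locales (auto intro: one uminus add mult algebraic_int_add algebraic_int_mult)

lemma quadratic_extension:
  assumes "\<gamma>\<^sup>2 \<in> F"
  shows "complex_subfield {u + v * \<gamma> |u v. u \<in> F \<and> v \<in> F}" (is "complex_subfield ?E")
proof
  have EI: "u + v * \<gamma> \<in> ?E" if "u \<in> F" "v \<in> F" for u v
    using that by blast
  show "1 \<in> ?E" using EI[OF one zero] by simp
  fix x assume "x \<in> ?E"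
  then obtain u v where x: "x = u + v * \<gamma>" "u \<in> F" "v \<in> F" by blast
  show "- x \<in> ?E" using EI[OF uminus uminus, of u v] x by simp
  show "inverse x \<in> ?E"
  \<comment> \<open>\<gamma> may lie in \<open>F\<close>, so the conjugate factor can vanish for
    nonzero \<open>x\<close>; then \<open>x = 2 * u\<close> is itself in \<open>F\<close>.\<close>
  proof (cases "x = 0 \<or> u = v * \<gamma>")
    case True
    then have "inverse x \<in> F"
    proof
      assume "u = v * \<gamma>"
      then have "x = 2 * u" using x(1) by simp
      then show ?thesis by (simp only:) (intro inverse mult numeral x(2))
    qed (simp add: zero)
    then show ?thesis using EI[OF _ zero, of "inverse x"] by simp
  next
    case False
    \<comment> \<open>The relative norm, used to rationalise the denominator.\<close>
    let ?N = "u\<^sup>2 - v\<^sup>2 * \<gamma>\<^sup>2"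
    have N: "x * (u - v * \<gamma>) = ?N" by (simp add: x(1) power2_eq_square algebra_simps)
    with False have "?N \<noteq> 0" by auto
    have "u / ?N + (- v / ?N) * \<gamma> = (u - v * \<gamma>) / ?N"
      by (simp add: diff_divide_distrib)
    then have "x * (u / ?N + (- v / ?N) * \<gamma>) = x * (u - v * \<gamma>) / ?N"
      by (simp only: times_divide_eq_right)
    also have "\<dots> = 1" using N \<open>?N \<noteq> 0\<close> by simp
    finally have "inverse x = u / ?N + (- v / ?N) * \<gamma>" by (rule inverse_unique)
    then show ?thesis
      using EI[of "u / ?N" "- v / ?N"] x assms by (simp add: divide diff mult power2 uminus)
  qed
  fix y assume "y \<in> ?E"
  then obtain u' v' where y: "y = u' + v' * \<gamma>" "u' \<in> F" "v' \<in> F" by blast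
  have "x + y = (u + u') + (v + v') * \<gamma>" by (simp add: x y algebra_simps)
  then show "x + y \<in> ?E" by (simp only:) (intro EI add x y)
  have "x * y = (u * u' + v * v' * \<gamma>\<^sup>2) + (u * v' + v * u') * \<gamma>"
    by (simp add: x y algebra_simps power2_eq_square)
  then show "x * y \<in> ?E" by (simp only:) (intro EI add mult x y assms)
qed

end

lemma complex_subfield_Rats: "complex_subfield \<rat>"
  by unfold_locales auto

section \<open>Translating generated fields into complex subfields\<close>

lemma ring_of_type_algebra_simps:
  "\<one>\<^bsub>ring_of_type_algebra\<^esub> = (1 :: 'a::field)" "\<zero>\<^bsub>ring_of_type_algebra\<^esub> = (0 :: 'a)"
  "x \<oplus>\<^bsub>ring_of_type_algebra\<^esub> y = (x + y :: 'a)" "x \<otimes>\<^bsub>ring_of_type_algebra\<^esub> y = (x * y :: 'a)"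
  "x \<in> carrier ring_of_type_algebra"
  by (simp_all add: ring_of_type_algebra_def)

lemma a_inv_ring_of_type_algebra: "\<ominus>\<^bsub>ring_of_type_algebra\<^esub> x = (- x :: 'a::field)"
proof -
  interpret field "ring_of_type_algebra :: 'a ring" by (rule field_from_type_algebra)
  show ?thesis by (rule minus_equality) (simp_all add: ring_of_type_algebra_simps)
qed

lemma m_inv_ring_of_type_algebra:
  "x \<noteq> 0 \<Longrightarrow> inv\<^bsub>ring_of_type_algebra\<^esub> x = inverse (x :: 'a::field)"
proof -
  interpret field "ring_of_type_algebra :: 'a ring" by (rule field_from_type_algebra)
  show "x \<noteq> 0 \<Longrightarrow> ?thesis" by (rule comm_inv_char) (simp_all add: ring_of_type_algebra_simps)
qed

lemma rat_adjoin_subfield: "complex_subfield (rat_adjoin A)"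
proof
  show "inverse x \<in> rat_adjoin A" if "x \<in> rat_adjoin A" for x
  proof (cases "x = 0")
    case False
    with generate_field.m_inv[of x ring_of_type_algebra A] that show ?thesis
      by (simp add: rat_adjoin_def ring_of_type_algebra_simps m_inv_ring_of_type_algebra)
  qed (use that in simp)
qed (use generate_field.one[of ring_of_type_algebra A] generate_field.a_inv[of _ ring_of_type_algebra A]
      generate_field.eng_add[of _ ring_of_type_algebra A] generate_field.eng_mult[of _ ring_of_type_algebra A]
    in \<open>simp_all add: rat_adjoin_def ring_of_type_algebra_simps a_inv_ring_of_type_algebra\<close>)

lemma rat_adjoin_incl: "x \<in> A \<Longrightarrow> x \<in> rat_adjoin A"
  unfolding rat_adjoin_def by (rule generate_field.incl)

text \<open>Minimality of the generated field; it later yields coordinates for the elements of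
  \<open>K\<close>.\<close>

lemma rat_adjoin_subset:
  assumes "complex_subfield F" and "A \<subseteq> F"
  shows "rat_adjoin A \<subseteq> F"
proof
  interpret complex_subfield F by fact
  fix x assume "x \<in> rat_adjoin A"
  then show "x \<in> F"
    unfolding rat_adjoin_def
    by (induction rule: generate_field.induct)
      (use assms(2) in \<open>auto simp: ring_of_type_algebra_simps a_inv_ring_of_type_algebra
        m_inv_ring_of_type_algebra intro: one uminus add mult inverse\<close>)
qed

section \<open>The quadratic step and the tower of fields\<close>

text \<open>
  With \<open>c = (1 + \<gamma>)/2\<close> and \<open>x = u + v\<gamma>\<close>, the numbers \<open>t\<close> and \<open>w\<close> of the proof are the relative traces of
  \<open>x\<close> and \<open>x c\<close>, and \<open>d x = (d + 1)/2 t - w + 2 w c - t c\<close>.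
\<close>

lemma sum_of_squares_quadratic_step:
  assumes "complex_subfield K" and "complex_subfield F"
    and "- 1 \<in> sums_of_squares (ring_of_integers K)"
    and F: "\<And>y. y \<in> F \<Longrightarrow> algebraic_int y \<Longrightarrow> y \<in> sums_of_squares (ring_of_integers K)"
    and "\<gamma>\<^sup>2 = of_int d" and "d mod 4 = 1" and "\<gamma> \<in> K"
    and "u \<in> F" and "v \<in> F" and "u + v * \<gamma> \<in> K"
    and int: "algebraic_int (u + v * \<gamma>)" "algebraic_int (u - v * \<gamma>)"
  shows "u + v * \<gamma> \<in> sums_of_squares (ring_of_integers K)"
proof -
  let ?S = "sums_of_squares (ring_of_integers K)"
  interpret K: complex_subfield K by fact
  interpret F: complex_subfield F by fact
  interpret R: complex_subring "ring_of_integers K" by (rule K.ring_of_integers_subring)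
  interpret S: complex_subring ?S by (rule R.sos_subring) fact
  define l where "l = d div 4"
  have d: "d = 4 * l + 1" unfolding l_def using \<open>d mod 4 = 1\<close> by presburger
  have \<gamma>2: "\<gamma> * \<gamma> = 4 * of_int l + 1" using \<open>\<gamma>\<^sup>2 = of_int d\<close> d by (simp add: power2_eq_square)
  define c c' where "c = (1 + \<gamma>) / 2" and "c' = (1 - \<gamma>) / 2"
  have cc: "c\<^sup>2 = c + of_int l" "c'\<^sup>2 = c' + of_int l"
    using \<gamma>2 by (simp_all add: c_def c'_def power2_eq_square field_simps)
  then have alg: "algebraic_int c" "algebraic_int c'" by (auto intro: algebraic_int_quadratic)
  have "c \<in> K" unfolding c_def by (intro K.divide K.add K.one K.numeral \<open>\<gamma> \<in> K\<close>)
  with alg cc have "c \<in> ?S"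
    by (intro R.sos_quadratic[OF assms(3)]) (auto simp: ring_of_integers_def)
  define t w where "t = 2 * u" and "w = u + of_int d * v"
  \<comment> \<open>Being traces, \<open>t\<close> and \<open>w\<close> are integral elements of
    \<open>F\<close>, so the hypothesis \<open>F\<close> applies to them.\<close>
  have "t = (u + v * \<gamma>) + (u - v * \<gamma>)" by (simp add: t_def)
  then have "algebraic_int t" using int by (metis algebraic_int_add)
  then have "t \<in> ?S" unfolding t_def by (intro F F.mult F.numeral \<open>u \<in> F\<close>)
  have "(u + v * \<gamma>) * c + (u - v * \<gamma>) * c' = u + v * (\<gamma> * \<gamma>)"
    by (simp add: c_def c'_def field_simps)
  then have "w = (u + v * \<gamma>) * c + (u - v * \<gamma>) * c'"
    by (simp add: \<gamma>2 w_def d)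
  then have "algebraic_int w" using int alg by (metis algebraic_int_add algebraic_int_mult)
  then have "w \<in> ?S" unfolding w_def by (intro F F.add F.mult F.of_int \<open>u \<in> F\<close> \<open>v \<in> F\<close>)
  \<comment> \<open>The coefficient of \<gamma> on the right is \<open>w - u = d v\<close>, whence
    the factor \<open>d\<close>; it is odd and can be cancelled.\<close>
  have "of_int d * (u + v * \<gamma>) = of_int (2 * l + 1) * t - w + w * (1 + \<gamma>) - u * (1 + \<gamma>)"
    by (simp add: d t_def w_def algebra_simps)
  also have "\<dots> = of_int (2 * l + 1) * t - w + 2 * w * c - t * c"
    by (simp add: t_def c_def)
  also have "\<dots> \<in> ?S"
    by (intro S.diff S.add S.mult S.of_int S.numeral \<open>t \<in> ?S\<close> \<open>w \<in> ?S\<close> \<open>c \<in> ?S\<close>)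
  finally have "of_int d * (u + v * \<gamma>) \<in> ?S" .
  moreover have "odd d" by (simp add: d)
  moreover have "u + v * \<gamma> \<in> ring_of_integers K"
    using int(1) \<open>u + v * \<gamma> \<in> K\<close> by (simp add: ring_of_integers_def)
  ultimately show ?thesis using R.sos_cancel_odd[OF assms(3)] by simp
qed

theorem theorem2:
  fixes m n :: nat and K :: "complex set"
  assumes "m \<noteq> n"
    and "m > 0" and "n > 0"
    and "squarefree m" and "squarefree n"
    and "m mod 4 = 3" and "n mod 4 = 1"
    and "K = rat_adjoin {csqrt (- of_nat m), csqrt (of_nat n)}"
  shows "sums_of_squares (ring_of_integers K) = ring_of_integers K"
proof
  let ?S = "sums_of_squares (ring_of_integers K)"
  show "?S \<subseteq> ring_of_integers K" by (auto simp: sums_of_squares_def)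
  define \<alpha> \<beta> where "\<alpha> = csqrt (- of_nat m)" and "\<beta> = csqrt (of_nat n)"
  have \<alpha>2: "\<alpha>\<^sup>2 = of_int (- int m)" and \<beta>2: "\<beta>\<^sup>2 = of_int (int n)"
    by (simp_all only: \<alpha>_def \<beta>_def power2_csqrt of_int_minus of_int_of_nat_eq)
  have dm: "- int m mod 4 = 1" and dn: "int n mod 4 = 1"
    using \<open>m mod 4 = 3\<close> \<open>n mod 4 = 1\<close> by presburger+
  have "\<alpha> = \<i> * of_real (sqrt m)"
    by (simp add: \<alpha>_def)
  then have "cnj \<alpha> = - \<alpha>" by simp
  have "\<beta> \<in> \<real>"
    by (simp add: \<beta>_def)
  have K: "complex_subfield K" using assms(8) rat_adjoin_subfield by simp
  interpret K: complex_subfield K by fact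
  interpret R: complex_subring "ring_of_integers K" by (rule K.ring_of_integers_subring)
  have "\<alpha> \<in> K" "\<beta> \<in> K" unfolding assms(8) \<alpha>_def \<beta>_def by (auto intro: rat_adjoin_incl)
  have "algebraic_int \<alpha>"
    unfolding \<alpha>_def by (intro algebraic_int_csqrt algebraic_int_minus algebraic_int_of_nat)
  then have "\<alpha> \<in> ring_of_integers K"
    using \<open>\<alpha> \<in> K\<close> by (simp add: ring_of_integers_def)
  then have "\<alpha>\<^sup>2 + of_nat (m - 1) \<in> ?S" by (intro R.sos_add R.sos_square R.sos_of_nat)
  \<comment> \<open>Positivity of \<open>m\<close> makes the truncated \<open>m - 1\<close> the true
    difference.\<close>
  then have m1: "- 1 \<in> ?S" using \<open>m > 0\<close> \<alpha>2 by (simp add: of_nat_diff)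
  interpret S: complex_subring ?S by (rule R.sos_subring) fact

  \<comment> \<open>Adjoining the real root first lets complex conjugation act as the conjugation of
    \<open>K\<close> over \<open>L\<close>.\<close>
  define L where "L = {u + v * \<beta> |u v. u \<in> \<rat> \<and> v \<in> \<rat>}"
  have L: "complex_subfield L" unfolding L_def
    using \<beta>2 by (intro complex_subfield.quadratic_extension complex_subfield_Rats) simp
  interpret L: complex_subfield L by fact
  have "(\<rat> :: complex set) \<subseteq> \<real>"
    by (auto elim!: Rats_cases')
  then have "L \<subseteq> \<real>"
    using \<open>\<beta> \<in> \<real>\<close> by (auto simp: L_def subset_iff)
  have "L \<subseteq> K"
    using K.Rats_subset \<open>\<beta> \<in> K\<close> by (auto simp: L_def intro!: K.add K.mult)
  have "\<beta> \<in> L" unfolding L_def by (intro CollectI exI[of _ 0] exI[of _ 1]) simp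

  \<comment> \<open>Base of the tower: rational algebraic integers are ordinary integers.\<close>
  have rat: "y \<in> ?S" if "y \<in> \<rat>" "algebraic_int y" for y
    using rational_algebraic_int_is_int[OF that(2,1)] by (auto elim!: Ints_cases intro: S.of_int)
  have real: "y \<in> ?S" if y: "y \<in> L" "algebraic_int y" for y
  \<comment> \<open>The case \<open>n = 1\<close> is allowed; \<beta> is then rational and
    \<open>L\<close> collapses to the rationals.\<close>
  proof (cases "\<beta> \<in> \<rat>")
    case True
    with y(1) have "y \<in> \<rat>" by (auto simp: L_def)
    then show ?thesis using y(2) by (rule rat)
  next
    case False
    obtain u v where uv: "y = u + v * \<beta>" "u \<in> \<rat>" "v \<in> \<rat>" using y(1) by (auto simp: L_def)
    have "algebraic_int (u - v * \<beta>)"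
      using False uv y(2) \<beta>2 by (intro algebraic_int_quadratic_conjugate) auto
    then show ?thesis
      using sum_of_squares_quadratic_step[OF K complex_subfield_Rats m1 rat \<beta>2 dn \<open>\<beta> \<in> K\<close>]
        uv y \<open>L \<subseteq> K\<close> by blast
  qed

  show "ring_of_integers K \<subseteq> ?S"
  proof
    fix x assume "x \<in> ring_of_integers K"
    then have x: "x \<in> K" "algebraic_int x" by (auto simp: ring_of_integers_def)
    \<comment> \<open>This subfield contains both generators, hence all of \<open>K\<close>.\<close>
    let ?E = "{u + v * \<alpha> |u v. u \<in> L \<and> v \<in> L}"
    have "\<alpha>\<^sup>2 \<in> L" unfolding \<alpha>2 by (rule L.of_int)
    then have "complex_subfield ?E" by (rule L.quadratic_extension)
    moreover have "\<alpha> = 0 + 1 * \<alpha>" "\<beta> = \<beta> + 0 * \<alpha>" by simp_all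
    then have "{\<alpha>, \<beta>} \<subseteq> ?E" using L.zero L.one \<open>\<beta> \<in> L\<close> by blast
    ultimately have "K \<subseteq> ?E" unfolding assms(8) \<alpha>_def \<beta>_def by (rule rat_adjoin_subset)
    then obtain u v where uv: "x = u + v * \<alpha>" "u \<in> L" "v \<in> L" using x(1) by blast
    \<comment> \<open>\<open>L\<close> is real and \<alpha> is purely imaginary; conjugation
      preserves integrality.\<close>
    have "cnj x = u - v * \<alpha>"
      using uv \<open>L \<subseteq> \<real>\<close> \<open>cnj \<alpha> = - \<alpha>\<close> by (auto simp: Reals_cnj_iff subset_iff)
    then have "algebraic_int (u - v * \<alpha>)" using x(2) by (metis algebraic_int_cnj)
    then show "x \<in> ?S"
      using sum_of_squares_quadratic_step[OF K L m1 real \<alpha>2 dm \<open>\<alpha> \<in> K\<close>] uv x by blast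
  qed
qed
end
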